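(* There exists an absolute constant $c>0$ such that for every $N$ there is a convex set $A\subset\mathbb{R}$ with $|A|\geq N$ containing at least $c|A|^{3/2}$ non-trivial three-term arithmetic progressions.
   Context: A convex set is a finite set $A=\{a_1<\cdots<a_n\}\subset\mathbb{R}$ whose consecutive differences $d_i=a_{i+1}-a_i$ ($1\le i\le n-1$) form a strictly increasing sequence. A three-term arithmetic progression in $A$ is a triple $(a,b,c)\in A^3$ with $2a=b+c$; it is non-trivial unless $a=b=c$. *)

theory Defs
  imports Complex_Main
begin

text \<open>
  The elements are indexed from 0: if the elements of a finite set \<open>A\<close> in increasing order are
  \<open>a 0 < \<dots> < a (n - 1)\<close>, then \<open>consec_diff A i = a (i + 1) - a i\<close> is meaningful
  for \<open>i < n - 1\<close>.
\<close>

definition consec_diff :: "real set \<Rightarrow> nat \<Rightarrow> real" where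
  "consec_diff A i = sorted_list_of_set A ! (i + 1) - sorted_list_of_set A ! i"

text \<open>Unrelated to convexity in the sense of line segments, the library's \<open>convex\<close>.\<close>

definition convex_set :: "real set \<Rightarrow> bool" where
  "convex_set A \<longleftrightarrow> finite A \<and> strict_mono_on {..<card A - 1} (consec_diff A)"

text \<open>
  Progressions are ordered triples with the midpoint first, so \<open>(a, b, c)\<close> and
  \<open>(a, c, b)\<close> are counted separately.
\<close>

definition nontrivial_3aps :: "real set \<Rightarrow> (real \<times> real \<times> real) set" where
  "nontrivial_3aps A =
     {(a, b, c). a \<in> A \<and> b \<in> A \<and> c \<in> A \<and> 2 * a = b + c \<and> \<not> (a = b \<and> b = c)}"

end

theory Submission
  imports Defs
begin

text \<open>
  The convex set contains \<open>m\<close> arithmetic progressions of length \<open>m\<close>, and each of them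
  contributes on the order of \<open>m\<^sup>2\<close> three-term progressions, while the set has only
  \<open>O(m\<^sup>2)\<close> elements. The point \<open>grid m k h\<close> is the \<open>k\<close>-th term of the \<open>h\<close>-th progression.
  For fixed \<open>k\<close> the points form a block in which the gap from \<open>h\<close> to \<open>h + 1\<close> is
  \<open>m + k + (2 h + 1) / (4 m)\<close>, so the gaps increase within \<open>(m + k, m + k + 1/2)\<close>.
  Between block \<open>k\<close> and block \<open>k + 1\<close> one inserts \<open>O(m)\<close> further points with increasing gaps
  in \<open>(m + k + 1/2, m + k + 1)\<close>. The distance between consecutive blocks is of order
  \<open>m\<^sup>2\<close>, large enough for some number of such gaps to bridge it exactly.
\<close>

section \<open>Finite sets described by their gaps\<close>

text \<open>For positive gaps, convexity of the set of visited points reduces to sortedness of the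
  gap list.\<close>

primrec walk :: "real \<Rightarrow> real list \<Rightarrow> real list" where
  "walk x [] = [x]"
| "walk x (d # ds) = x # walk (x + d) ds"

lemma length_walk [simp]: "length (walk x ds) = Suc (length ds)"
  by (induction ds arbitrary: x) auto

lemma nth_walk: "i \<le> length ds \<Longrightarrow> walk x ds ! i = x + sum_list (take i ds)"
proof (induction ds arbitrary: x i)
  case (Cons d ds)
  then show ?case by (cases i) auto
qed simp

lemma set_walk: "set (walk x ds) = (\<lambda>i. x + sum_list (take i ds)) ` {..length ds}"
  by (auto simp: set_conv_nth nth_walk image_iff less_Suc_eq_le) (metis nth_walk)

lemma set_walk_append:
  "set (walk x (ds @ es)) = set (walk x ds) \<union> set (walk (x + sum_list ds) es)"
proof (induction ds arbitrary: x)
  case Nil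
  then show ?case by (cases es) auto
next
  case (Cons d ds)
  then show ?case by (auto simp: add.assoc)
qed

lemma sorted_walk:
  assumes "\<forall>d\<in>set ds. 0 < d"
  shows "sorted_wrt (<) (walk x ds) \<and> (\<forall>y\<in>set (walk x ds). x \<le> y)"
  using assms by (induction ds arbitrary: x) force+

lemma
  assumes "\<forall>d\<in>set ds. 0 < d"
  shows card_walk: "card (set (walk x ds)) = Suc (length ds)"
    and sorted_list_of_set_walk: "sorted_list_of_set (set (walk x ds)) = walk x ds"
  using sorted_walk [OF assms, of x]
  by (auto simp: strict_sorted_iff distinct_card sorted_list_of_set.idem_if_sorted_distinct)

lemma convex_set_walk:
  assumes "\<forall>d\<in>set ds. 0 < d" and "sorted_wrt (<) ds"
  shows "convex_set (set (walk x ds))"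
proof -
  have "consec_diff (set (walk x ds)) i = ds ! i" if "i < length ds" for i
    using that
    by (simp add: consec_diff_def sorted_list_of_set_walk [OF assms(1)] nth_walk
        take_Suc_conv_app_nth)
  then show ?thesis
    using assms(2)
    by (auto simp: convex_set_def card_walk [OF assms(1)] strict_mono_on_def
        sorted_wrt_iff_nth_less)
qed

text \<open>The interval \<open>(w / hi, w / lo)\<close> is longer than 1, so it contains an integer
  \<open>n\<close>. Then \<open>n\<close> equal gaps \<open>w / n\<close> fit between
  \<open>lo\<close> and \<open>hi\<close>, and a small zero-sum perturbation makes them strictly
  increasing.\<close>

lemma increasing_list_with_sum:
  fixes lo hi w :: real
  assumes "0 < lo" and "lo < hi" and "w / lo - w / hi > 1"
  obtains ds where "sorted_wrt (<) ds" and "set ds \<subseteq> {lo<..<hi}"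
    and "sum_list ds = w" and "real (length ds) \<le> w / lo"
proof -
  have "w > 0"
  proof (rule ccontr)
    assume "\<not> w > 0"
    then have "w / lo \<le> w / hi"
      using assms by (intro divide_left_mono_neg) auto
    then show False using assms by simp
  qed
  define n where "n = nat (\<lfloor>w / hi\<rfloor> + 1)"
  have "w / hi \<ge> 0" using assms \<open>w > 0\<close> by auto
  then have n: "w / hi < n" "n < w / lo" "n > 0"
    unfolding n_def using assms(3) by linarith+
  define avg where "avg = w / n"
  have avg: "lo < avg" "avg < hi"
    using n assms \<open>w > 0\<close> by (auto simp: avg_def field_simps)
  \<comment> \<open>The offsets \<open>2 * i + 1 - n\<close> for \<open>i < n\<close> are symmetric
    about 0 and smaller than \<open>n\<close> in absolute value, so this scale keeps every gap
    inside the interval.\<close>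
  define e where "e = min (avg - lo) (hi - avg) / n"
  have e: "e > 0" "e * n \<le> avg - lo" "e * n \<le> hi - avg"
    using avg n by (auto simp: e_def)
  define f where "f i = avg + e * (2 * real i + 1 - n) " for i :: nat
  define ds where "ds = map f [0..<n]"
  have "lo < f i \<and> f i < hi" if "i < n" for i
  proof -
    have "e * (- n) < e * (2 * real i + 1 - n)"
      using that e(1) by (intro mult_strict_left_mono) auto
    moreover have "e * (2 * real i + 1 - n) < e * n"
      using that e(1) by (intro mult_strict_left_mono) auto
    ultimately show ?thesis using e(2,3) unfolding f_def by linarith
  qed
  then have "set ds \<subseteq> {lo<..<hi}" by (auto simp: ds_def)
  moreover have "sorted_wrt (<) ds"
    using e(1) by (auto simp: ds_def f_def sorted_wrt_iff_nth_less)
  moreover have "sum_list ds = w"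
  proof -
    \<comment> \<open>The correction term vanishes at \<open>k = n\<close>.\<close>
    have "(\<Sum>i<k. f i) = k * avg + e * (real k * (real k - n))" for k
      by (induction k) (auto simp: f_def algebra_simps)
    from this [of n] show ?thesis
      using n by (simp add: ds_def interv_sum_list_conv_sum_set_nat atLeast0LessThan avg_def)
  qed
  moreover have "real (length ds) \<le> w / lo"
    using n by (simp add: ds_def)
  ultimately show ?thesis by (intro that)
qed

section \<open>The grid points and a gap list visiting them\<close>

text \<open>Affine in \<open>k\<close>, which yields the progressions. The slope
  \<open>10 * m ^ 2 + h\<close> depends on \<open>h\<close>, so all gaps grow by 1 from one block to
  the next.\<close>

definition grid :: "nat \<Rightarrow> nat \<Rightarrow> nat \<Rightarrow> real" where
  "grid m k h = real m * h + (real h)\<^sup>2 / (4 * m) + k * (10 * (real m)\<^sup>2 + h)"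

lemma grid_block:
  assumes "k < m"
  obtains ds where "sorted_wrt (<) ds" and "set ds \<subseteq> {real (m + k)<..<real (m + k) + 1}"
    and "sum_list ds = 10 * (real m)\<^sup>2" and "length ds \<le> 11 * m"
    and "\<forall>h<m. grid m k h \<in> set (walk (k * (10 * (real m)\<^sup>2)) ds)"
proof -
  define g where "g = real (m + k)"
  define f where "f h = g + (2 * real h + 1) / (4 * m)" for h :: nat
  \<comment> \<open>With \<open>m\<close> gaps the walk ends at \<open>grid m k m\<close>, one step
    past the last required point; the filler \<open>fs\<close> leads from there to
    \<open>grid m (k + 1) 0\<close>.\<close>
  define bs where "bs = map f [0..<m]"
  have m: "m > 0" "real m > 0" "real m \<ge> 1" using assms by auto
  have f: "g < f h" "f h < g + 1/2" if "h < m" for h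
    using that m by (auto simp: f_def field_simps)
  have sum_f: "(\<Sum>i<h. f i) = g * h + (real h)\<^sup>2 / (4 * m)" for h
    using m by (induction h) (auto simp: f_def field_simps power2_eq_square)
  have sum_take: "sum_list (take h bs) = g * h + (real h)\<^sup>2 / (4 * m)" if "h \<le> m" for h
    using that
    by (simp add: bs_def take_map interv_sum_list_conv_sum_set_nat atLeast0LessThan sum_f)
  have len_bs: "length bs = m" by (simp add: bs_def)
  define w where "w = 10 * (real m)\<^sup>2 - sum_list bs"
  have g: "m \<le> g" "g + 1 \<le> 2 * m"
    using assms by (auto simp: g_def)
  have sum_bs: "sum_list bs = g * m + m / 4"
    using sum_take [of m] m by (simp add: len_bs power2_eq_square)
  have gm: "g * m \<le> (2 * m - 1) * m" "0 \<le> g * m"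
    using g m by (auto intro!: mult_right_mono)
  then have w: "8 * (real m)\<^sup>2 < w" "w \<le> 10 * (real m)\<^sup>2"
    using m unfolding w_def sum_bs by (auto simp: power2_eq_square algebra_simps)
  \<comment> \<open>The filler interval has width 1/2, so a suitable number of gaps exists once
    \<open>2 * ((g + 1/2) * (g + 1)) < w\<close>. The left side is at most \<open>8 * m ^ 2\<close>;
    the constant 10 in \<open>grid\<close> keeps \<open>w\<close> above that.\<close>
  have "(g + 1/2) * (g + 1) \<le> (2 * m) * (2 * real m)"
    using g m by (intro mult_mono) auto
  then have "2 * ((g + 1/2) * (g + 1)) < w"
    using w by (simp add: power2_eq_square)
  moreover have "w / (g + 1/2) - w / (g + 1) = w / (2 * ((g + 1/2) * (g + 1)))"
    using g m by (simp add: divide_simps) (simp add: algebra_simps)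
  ultimately have "w / (g + 1/2) - w / (g + 1) > 1"
    using g m by simp
  then obtain fs where fs: "sorted_wrt (<) fs" "set fs \<subseteq> {g + 1/2<..<g + 1}"
    "sum_list fs = w" "real (length fs) \<le> w / (g + 1/2)"
    using g m increasing_list_with_sum [of "g + 1/2" "g + 1" w] by auto
  show ?thesis
  proof (rule that [of "bs @ fs"])
    have "sorted_wrt (<) bs"
      using m by (auto simp: bs_def f_def sorted_wrt_iff_nth_less divide_strict_right_mono)
    moreover have "set bs \<subseteq> {g<..<g + 1/2}"
      using f by (auto simp: bs_def)
    ultimately show "sorted_wrt (<) (bs @ fs)"
      and "set (bs @ fs) \<subseteq> {real (m + k)<..<real (m + k) + 1}"
      using fs unfolding g_def [symmetric] by (force simp: sorted_wrt_append)+
    show "sum_list (bs @ fs) = 10 * (real m)\<^sup>2"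
      using fs by (simp add: w_def)
    have "w / (g + 1/2) \<le> 10 * (real m)\<^sup>2 / m"
      using w g m by (intro frac_le) auto
    also have "\<dots> = 10 * m" by (simp add: power2_eq_square)
    finally have "length fs \<le> 10 * m" using fs(4) by linarith
    then show "length (bs @ fs) \<le> 11 * m" by (simp add: len_bs)
    show "\<forall>h<m. grid m k h \<in> set (walk (k * (10 * (real m)\<^sup>2)) (bs @ fs))"
    proof (intro allI impI)
      fix h assume "h < m"
      then have "grid m k h = k * (10 * (real m)\<^sup>2) + sum_list (take h (bs @ fs))"
        by (simp add: grid_def len_bs sum_take g_def algebra_simps)
      then show "grid m k h \<in> set (walk (k * (10 * (real m)\<^sup>2)) (bs @ fs))"
        unfolding set_walk using \<open>h < m\<close> by (intro image_eqI [of _ _ h]) (auto simp: len_bs)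
    qed
  qed
qed

text \<open>Induction over blocks. The bound \<open>m + n\<close> on the gaps so far is carried
  along because the gaps of block \<open>n\<close> all exceed it, so concatenation stays
  sorted.\<close>

lemma grid_gaps:
  assumes "n \<le> m"
  shows "\<exists>ds. sorted_wrt (<) ds \<and> (\<forall>d\<in>set ds. 0 < d \<and> d < real (m + n)) \<and>
    sum_list ds = n * (10 * (real m)\<^sup>2) \<and> length ds \<le> n * (11 * m) \<and>
    (\<forall>k<n. \<forall>h<m. grid m k h \<in> set (walk 0 ds))"
  using assms
proof (induction n)
  case (Suc n)
  then obtain ds where ds: "sorted_wrt (<) ds" "\<forall>d\<in>set ds. 0 < d \<and> d < real (m + n)"
    "sum_list ds = n * (10 * (real m)\<^sup>2)" "length ds \<le> n * (11 * m)"
    "\<forall>k<n. \<forall>h<m. grid m k h \<in> set (walk 0 ds)"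
    by auto
  from Suc.prems have "n < m" by simp
  then obtain es where es: "sorted_wrt (<) es"
    "set es \<subseteq> {real (m + n)<..<real (m + n) + 1}"
    "sum_list es = 10 * (real m)\<^sup>2" "length es \<le> 11 * m"
    "\<forall>h<m. grid m n h \<in> set (walk (n * (10 * (real m)\<^sup>2)) es)"
    by (rule grid_block)
  have "0 < d \<and> d < real (m + Suc n)" if "d \<in> set (ds @ es)" for d
    using that ds(2) es(2) by force
  moreover have "sorted_wrt (<) (ds @ es)"
    using ds(1,2) es(1,2) by (fastforce simp: sorted_wrt_append)
  moreover have "\<forall>k<Suc n. \<forall>h<m. grid m k h \<in> set (walk 0 (ds @ es))"
    using ds(3,5) es(5) by (auto simp: set_walk_append less_Suc_eq)
  moreover have "sum_list (ds @ es) = Suc n * (10 * (real m)\<^sup>2)"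
    using ds(3) es(3) by (simp add: algebra_simps)
  moreover have "length (ds @ es) \<le> Suc n * (11 * m)"
    using ds(4) es(4) by simp
  ultimately show ?case by blast
qed (auto intro: exI [of _ "[]"])

section \<open>Distinctness of grid points and the count\<close>

text \<open>A block stays within \<open>3 * m ^ 2\<close> of its first point, while first points are
  \<open>10 * m ^ 2\<close> apart.\<close>

lemma grid_less_block:
  assumes "k < k'" and "k < m" and "h < m"
  shows "grid m k h < grid m k' h'"
proof -
  define S where "S = (real m)\<^sup>2"
  have "S > 0" using assms by (simp add: S_def)
  have "(real h)\<^sup>2 / (4 * m) \<le> (real h)\<^sup>2 / 1"
    using assms by (intro divide_left_mono) auto
  also have "\<dots> \<le> S" using assms by (simp add: S_def)
  finally have "(real h)\<^sup>2 / (4 * m) \<le> S" .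
  moreover have "real m * h \<le> S" "real k * h \<le> S"
    using assms by (auto simp: S_def power2_eq_square intro!: mult_mono)
  ultimately have "grid m k h \<le> 3 * S + k * (10 * S)"
    unfolding grid_def S_def [symmetric] distrib_left by linarith
  also have "\<dots> < (real k + 1) * (10 * S)"
    using \<open>S > 0\<close> by (simp add: distrib_right)
  also have "\<dots> \<le> k' * (10 * S)"
    using assms \<open>S > 0\<close> by (intro mult_right_mono) auto
  also have "\<dots> \<le> grid m k' h'"
    by (simp add: grid_def S_def distrib_left)
  finally show ?thesis .
qed

lemma grid_less:
  assumes "h < h'" and "m > 0"
  shows "grid m k h < grid m k h'"
proof -
  have "real m * h < real m * h'" "real k * h \<le> real k * h'"
    using assms by (auto intro!: mult_left_mono)
  moreover have "(real h)\<^sup>2 / (4 * m) \<le> (real h')\<^sup>2 / (4 * m)"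
    using assms by (intro divide_right_mono power_mono) auto
  ultimately show ?thesis by (simp add: grid_def algebra_simps)
qed

lemma grid_eq_iff:
  assumes "k < m" "h < m" "k' < m" "h' < m"
  shows "grid m k h = grid m k' h' \<longleftrightarrow> k = k' \<and> h = h'"
  using assms grid_less_block [of k k' m h h'] grid_less_block [of k' k m h' h]
    grid_less [of h h' m k] grid_less [of h' h m k]
  by (cases k k' rule: linorder_cases; cases h h' rule: linorder_cases) auto

lemma card_nontrivial_3aps_grid:
  assumes "finite A" and "\<forall>k<3 * r. \<forall>h<3 * r. grid (3 * r) k h \<in> A"
  shows "3 * r ^ 3 \<le> card (nontrivial_3aps A)"
proof -
  let ?g = "grid (3 * r)"
  \<comment> \<open>For \<open>i < r\<close> and \<open>d \<le> r\<close> the index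
    \<open>i + 2 * d\<close> stays below \<open>3 * r\<close>; \<open>d \<ge> 1\<close> ensures
    non-triviality.\<close>
  let ?I = "{..<3 * r} \<times> {..<r} \<times> {1..r}"
  define f where "f = (\<lambda>(h, i, d). (?g (i + d) h, ?g i h, ?g (i + 2 * d) h))"
  have "inj_on f ?I"
    by (auto simp: f_def inj_on_def grid_eq_iff)
  moreover have "f ` ?I \<subseteq> nontrivial_3aps A"
    using assms(2) by (auto simp: f_def nontrivial_3aps_def grid_eq_iff) (auto simp: grid_def algebra_simps)
  moreover have "finite (nontrivial_3aps A)"
    by (rule finite_subset [of _ "A \<times> A \<times> A"]) (use assms in \<open>auto simp: nontrivial_3aps_def\<close>)
  ultimately have "card ?I \<le> card (nontrivial_3aps A)"
    by (rule card_inj_on_le)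
  then show ?thesis by (simp add: card_cartesian_product power3_eq_cube)
qed

theorem theorem1p2:
  shows "\<exists>c::real. c > 0 \<and>
    (\<forall>N::nat. \<exists>A::real set. convex_set A \<and> card A \<ge> N \<and>
       real (card (nontrivial_3aps A)) \<ge> c * real (card A) powr (3 / 2))"
proof (intro exI [of _ "1/576"] conjI allI)
  fix N :: nat
  define r where "r = Suc N"
  define m where "m = 3 * r"
  obtain ds where ds: "sorted_wrt (<) ds" "\<forall>d\<in>set ds. 0 < d" "length ds \<le> m * (11 * m)"
    and grid: "\<forall>k<m. \<forall>h<m. grid m k h \<in> set (walk 0 ds)"
    using grid_gaps [of m m] by auto
  define A where "A = set (walk 0 ds)"
  have "convex_set A"
    unfolding A_def using ds(2,1) by (rule convex_set_walk)
  moreover have "N \<le> card A"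
  proof -
    \<comment> \<open>Block 0 alone has \<open>m > N\<close> points.\<close>
    have "card {..<m} \<le> card A"
      by (rule card_inj_on_le [of "grid m 0"])
        (use grid in \<open>auto simp: A_def inj_on_def grid_eq_iff\<close>)
    then show ?thesis by (simp add: m_def r_def)
  qed
  moreover have "1/576 * real (card A) powr (3/2) \<le> real (card (nontrivial_3aps A))"
  proof -
    have "m * m \<ge> 1" by (simp add: m_def r_def)
    then have "card A \<le> 12 * (m * m)"
      using ds(3) unfolding A_def card_walk [OF ds(2)] by linarith
    \<comment> \<open>The bound \<open>108 * r ^ 2\<close> is rounded up to a square, whose power
      3/2 is \<open>(12 * r) ^ 3\<close>; the constant comes from
      \<open>12 ^ 3 = 576 * 3\<close>.\<close>
    also have "\<dots> \<le> (12 * r)\<^sup>2" by (simp add: m_def power2_eq_square)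
    finally have "real (card A) \<le> (12 * real r) powr 2"
      by (simp add: r_def flip: of_nat_le_iff [where 'a = real])
    then have "real (card A) powr (3/2) \<le> ((12 * real r) powr 2) powr (3/2)"
      by (intro powr_mono2) auto
    also have "\<dots> = (12 * real r) ^ 3"
      using powr_realpow [of "12 * real r" 3] unfolding powr_powr by (simp add: r_def)
    also have "\<dots> = 576 * real (3 * r ^ 3)" by (simp add: power_mult_distrib)
    also have "\<dots> \<le> 576 * real (card (nontrivial_3aps A))"
      using card_nontrivial_3aps_grid [of A r] grid
      by (intro mult_left_mono of_nat_mono) (auto simp: A_def m_def)
    finally show ?thesis by simp
  qed
  ultimately show "\<exists>A. convex_set A \<and> N \<le> card A \<and>
      1/576 * real (card A) powr (3/2) \<le> real (card (nontrivial_3aps A))"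
    by blast
qed simp

end
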